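(* Let a group $\Gamma$ act faithfully by order preserving transformations on a linearly ordered set $(I,\leq)$. If the action is proximal, then it is primitive. If the action is bounded and primitive, then it is proximal.
   Context: For $a,b\in I$ put $(a,b)=\{y\in I: a<y<b\}$. The support of $g$ is $\mathrm{supp}(g)=\{x\in I: g(x)\neq x\}$. The action is proximal if for every $a,b,c,d\in I$ with $a<b$ and $c<d$ there is $g\in\Gamma$ such that $g(a,b)\supseteq(c,d)$. The action is bounded if for every $g\in\Gamma$ there are $a,b\in I$ such that $\mathrm{supp}(g)\subseteq(a,b)$. The action is primitive if for every linearly ordered set $(J,\leq)$, every homomorphism $\Psi\colon\Gamma\to\mathrm{Aut}(J,\leq)$ and every order preserving (i.e. $x\le y\Rightarrow\psi(x)\le\psi(y)$) equivariant map $\psi\colon(I,\leq)\to(J,\leq)$ (that is, $\psi(\gamma x)=\Psi(\gamma)\psi(x)$ for all $\gamma\in\Gamma$, $x\in I$), the map $\psi$ is injective or $\psi(I)$ is a singleton. *)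

theory Defs
  imports "HOL-Algebra.Group_Action"
begin

text \<open>A linearly ordered set is a carrier \<open>I\<close> together with a relation \<open>r\<close> such that
  \<^term>\<open>linear_order_on I r\<close>; then \<open>(a, b) \<in> r - Id\<close> is the strict order \<open>a < b\<close>, and it
  entails \<open>a \<in> I\<close> and \<open>b \<in> I\<close>.\<close>

definition order_auto :: "'i set \<Rightarrow> 'i rel \<Rightarrow> ('i \<Rightarrow> 'i) set"
  where "order_auto I r = {f \<in> Bij I. \<forall>x y. (x, y) \<in> r \<longrightarrow> (f x, f y) \<in> r}"

definition OrderAutGroup :: "'i set \<Rightarrow> 'i rel \<Rightarrow> ('i \<Rightarrow> 'i) monoid"
  where "OrderAutGroup I r = BijGroup I \<lparr>carrier := order_auto I r\<rparr>"

definition open_interval :: "'i set \<Rightarrow> 'i rel \<Rightarrow> 'i \<Rightarrow> 'i \<Rightarrow> 'i set"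
  where "open_interval I r a b = {y \<in> I. (a, y) \<in> r - Id \<and> (y, b) \<in> r - Id}"

definition support_on :: "'i set \<Rightarrow> ('i \<Rightarrow> 'i) \<Rightarrow> 'i set"
  where "support_on I f = {x \<in> I. f x \<noteq> x}"

definition proximal_action ::
    "('g, 'm) monoid_scheme \<Rightarrow> 'i set \<Rightarrow> 'i rel \<Rightarrow> ('g \<Rightarrow> 'i \<Rightarrow> 'i) \<Rightarrow> bool"
  where "proximal_action G I r \<phi> \<longleftrightarrow>
    (\<forall>a\<in>I. \<forall>b\<in>I. \<forall>c\<in>I. \<forall>d\<in>I. (a, b) \<in> r - Id \<longrightarrow> (c, d) \<in> r - Id \<longrightarrow>
      (\<exists>g\<in>carrier G. open_interval I r c d \<subseteq> \<phi> g ` open_interval I r a b))"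

definition bounded_action ::
    "('g, 'm) monoid_scheme \<Rightarrow> 'i set \<Rightarrow> 'i rel \<Rightarrow> ('g \<Rightarrow> 'i \<Rightarrow> 'i) \<Rightarrow> bool"
  where "bounded_action G I r \<phi> \<longleftrightarrow>
    (\<forall>g\<in>carrier G. \<exists>a\<in>I. \<exists>b\<in>I. support_on I (\<phi> g) \<subseteq> open_interval I r a b)"

text \<open>HOL cannot quantify over the type of the elements of \<open>J\<close> inside a formula, so this type
  \<open>'j\<close> is a parameter. The choice \<open>'j = 'i\<close> already covers all linearly ordered sets \<open>J\<close>
  (of any type): see \<open>primitive_action_any_type\<close> below.\<close>

definition primitive_action ::
    "'j itself \<Rightarrow> ('g, 'm) monoid_scheme \<Rightarrow> 'i set \<Rightarrow> 'i rel \<Rightarrow> ('g \<Rightarrow> 'i \<Rightarrow> 'i) \<Rightarrow> bool"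
  where "primitive_action TYPE('j) G I r \<phi> \<longleftrightarrow>
    (\<forall>(J :: 'j set) s \<Psi> \<psi>.
      linear_order_on J s \<longrightarrow> \<Psi> \<in> hom G (OrderAutGroup J s) \<longrightarrow> \<psi> \<in> I \<rightarrow> J \<longrightarrow>
      (\<forall>x\<in>I. \<forall>y\<in>I. (x, y) \<in> r \<longrightarrow> (\<psi> x, \<psi> y) \<in> s) \<longrightarrow>
      (\<forall>\<gamma>\<in>carrier G. \<forall>x\<in>I. \<psi> (\<phi> \<gamma> x) = \<Psi> \<gamma> (\<psi> x)) \<longrightarrow>
      inj_on \<psi> I \<or> is_singleton (\<psi> ` I))"

lemma primitive_action_any_type:
  fixes G :: "('g, 'm) monoid_scheme" and I :: "'i set"
  assumes act: "group_action G I \<phi>"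
    and prim: "primitive_action TYPE('i) G I r \<phi>"
  shows "primitive_action TYPE('j) G I r \<phi>"
  unfolding primitive_action_def
proof (intro allI impI)
  fix J :: "'j set" and s \<Psi> \<psi>
  assume lin: "linear_order_on J s" and hom: "\<Psi> \<in> hom G (OrderAutGroup J s)"
    and maps: "\<psi> \<in> I \<rightarrow> J"
    and mono: "\<forall>x\<in>I. \<forall>y\<in>I. (x, y) \<in> r \<longrightarrow> (\<psi> x, \<psi> y) \<in> s"
    and equi: "\<forall>\<gamma>\<in>carrier G. \<forall>x\<in>I. \<psi> (\<phi> \<gamma> x) = \<Psi> \<gamma> (\<psi> x)"
  interpret group_action G I \<phi> by (fact act)
  interpret G: group G using group_hom by (simp add: group_hom_def)
  define \<sigma> where "\<sigma> = inv_into I \<psi>"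
  define K where "K = \<sigma> ` \<psi> ` I"
  define t where "t = {(x, y). x \<in> K \<and> y \<in> K \<and> (\<psi> x, \<psi> y) \<in> s}"
  define \<Theta> where "\<Theta> = (\<lambda>\<gamma>. \<lambda>x\<in>K. \<sigma> (\<psi> (\<phi> \<gamma> x)))"
  have KI: "K \<subseteq> I" unfolding K_def \<sigma>_def by (auto intro: inv_into_into)
  have \<psi>\<sigma>: "\<psi> (\<sigma> (\<psi> x)) = \<psi> x" if "x \<in> I" for x
    unfolding \<sigma>_def using that by (simp add: f_inv_into_f)
  have \<sigma>\<psi>: "\<sigma> (\<psi> x) = x" if "x \<in> K" for x
    using that \<psi>\<sigma> unfolding K_def by auto
  have \<sigma>K: "\<sigma> (\<psi> x) \<in> K" if "x \<in> I" for x using that unfolding K_def by auto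
  have \<phi>I: "\<phi> \<gamma> x \<in> I" if "\<gamma> \<in> carrier G" "x \<in> I" for \<gamma> x
    using that element_image by blast
  have \<Psi>: "\<Psi> \<gamma> \<in> order_auto J s" if "\<gamma> \<in> carrier G" for \<gamma>
    using hom that by (auto simp: hom_def OrderAutGroup_def)
  have comp: "\<phi> (\<gamma> \<otimes>\<^bsub>G\<^esub> \<delta>) x = \<phi> \<gamma> (\<phi> \<delta> x)"
    if "\<gamma> \<in> carrier G" "\<delta> \<in> carrier G" "x \<in> I" for \<gamma> \<delta> x
    using composition_rule that by simp
  have \<Theta>K: "\<Theta> \<gamma> x \<in> K" if "\<gamma> \<in> carrier G" "x \<in> K" for \<gamma> x
    unfolding \<Theta>_def using that KI \<phi>I \<sigma>K by auto
  have \<Theta>\<psi>: "\<Theta> \<gamma> (\<sigma> (\<psi> x)) = \<sigma> (\<psi> (\<phi> \<gamma> x))" if "\<gamma> \<in> carrier G" "x \<in> I" for \<gamma> x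
  proof -
    have "\<psi> (\<phi> \<gamma> (\<sigma> (\<psi> x))) = \<psi> (\<phi> \<gamma> x)"
      using equi that \<sigma>K KI \<psi>\<sigma> by (metis subsetD)
    then show ?thesis unfolding \<Theta>_def using that \<sigma>K by simp
  qed
  have \<Theta>comp: "\<Theta> (\<gamma> \<otimes>\<^bsub>G\<^esub> \<delta>) x = \<Theta> \<gamma> (\<Theta> \<delta> x)"
    if "\<gamma> \<in> carrier G" "\<delta> \<in> carrier G" "x \<in> K" for \<gamma> \<delta> x
  proof -
    have xI: "x \<in> I" using that KI by auto
    have "\<Theta> \<gamma> (\<Theta> \<delta> x) = \<Theta> \<gamma> (\<sigma> (\<psi> (\<phi> \<delta> x)))" unfolding \<Theta>_def using that by simp
    also have "\<dots> = \<sigma> (\<psi> (\<phi> \<gamma> (\<phi> \<delta> x)))" using \<Theta>\<psi> that \<phi>I xI by simp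
    also have "\<dots> = \<Theta> (\<gamma> \<otimes>\<^bsub>G\<^esub> \<delta>) x" unfolding \<Theta>_def using comp that xI by simp
    finally show ?thesis by simp
  qed
  have \<Theta>one: "\<Theta> \<one>\<^bsub>G\<^esub> x = x" if "x \<in> K" for x
  proof -
    have "\<phi> \<one>\<^bsub>G\<^esub> x = x" using id_eq_one that KI by (metis restrict_apply' subsetD)
    then show ?thesis unfolding \<Theta>_def using that \<sigma>\<psi> by simp
  qed
  have \<Theta>bij: "\<Theta> \<gamma> \<in> Bij K" if g: "\<gamma> \<in> carrier G" for \<gamma>
  proof -
    have "bij_betw (\<Theta> \<gamma>) K K"
      by (rule bij_betw_byWitness[where f' = "\<Theta> (inv\<^bsub>G\<^esub> \<gamma>)"])
        (use g \<Theta>K \<Theta>comp[symmetric] \<Theta>one in auto)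
    then show ?thesis unfolding Bij_def \<Theta>_def by auto
  qed
  have \<Theta>mono: "(\<Theta> \<gamma> x, \<Theta> \<gamma> y) \<in> t" if g: "\<gamma> \<in> carrier G" and xy: "(x, y) \<in> t" for \<gamma> x y
  proof -
    have K: "x \<in> K" "y \<in> K" and s: "(\<psi> x, \<psi> y) \<in> s" using xy unfolding t_def by auto
    have e: "\<psi> (\<Theta> \<gamma> z) = \<Psi> \<gamma> (\<psi> z)" if "z \<in> K" for z
    proof -
      have "z \<in> I" using that KI by auto
      then have "\<psi> (\<Theta> \<gamma> z) = \<psi> (\<phi> \<gamma> z)"
        unfolding \<Theta>_def using \<psi>\<sigma>[OF \<phi>I[OF g]] that by simp
      then show ?thesis using equi g \<open>z \<in> I\<close> by simp
    qed
    have "(\<Psi> \<gamma> (\<psi> x), \<Psi> \<gamma> (\<psi> y)) \<in> s" using \<Psi>[OF g] s unfolding order_auto_def by auto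
    then show ?thesis unfolding t_def using e K \<Theta>K g by auto
  qed
  have "\<Theta> \<in> hom G (OrderAutGroup K t)"
  proof (rule homI)
    fix \<gamma> assume "\<gamma> \<in> carrier G"
    then show "\<Theta> \<gamma> \<in> carrier (OrderAutGroup K t)"
      using \<Theta>bij \<Theta>mono by (auto simp: OrderAutGroup_def order_auto_def)
  next
    fix \<gamma> \<delta> assume g: "\<gamma> \<in> carrier G" "\<delta> \<in> carrier G"
    have "\<Theta> (\<gamma> \<otimes>\<^bsub>G\<^esub> \<delta>) = compose K (\<Theta> \<gamma>) (\<Theta> \<delta>)"
      by (rule extensionalityI[of _ K])
        (use g \<Theta>comp Bij_imp_extensional[OF \<Theta>bij] in \<open>auto simp: compose_def\<close>)
    then show "\<Theta> (\<gamma> \<otimes>\<^bsub>G\<^esub> \<delta>) = \<Theta> \<gamma> \<otimes>\<^bsub>OrderAutGroup K t\<^esub> \<Theta> \<delta>"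
      using g \<Theta>bij by (simp add: OrderAutGroup_def BijGroup_def)
  qed
  moreover have "linear_order_on K t"
  proof -
    have J: "\<psi> x \<in> J" if "x \<in> K" for x using that KI maps by auto
    have inj: "x = y" if "x \<in> K" "y \<in> K" "\<psi> x = \<psi> y" for x y using \<sigma>\<psi> that by metis
    have s: "refl_on J s" "trans s" "antisym s" "total_on J s"
      using lin by (auto simp: order_on_defs)
    have "refl_on K t" using s(1) J unfolding t_def refl_on_def by auto
    moreover have "trans t" using s(2) unfolding t_def trans_def by blast
    moreover have "antisym t" using s(3) inj unfolding t_def antisym_def by blast
    moreover have "total_on K t" using s(4) inj J unfolding t_def total_on_def by blast
    moreover have "t \<subseteq> K \<times> K" unfolding t_def by auto
    ultimately show ?thesis by (simp add: order_on_defs)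
  qed
  moreover have "(\<sigma> \<circ> \<psi>) \<in> I \<rightarrow> K" using \<sigma>K by auto
  moreover have "\<forall>x\<in>I. \<forall>y\<in>I. (x, y) \<in> r \<longrightarrow> ((\<sigma> \<circ> \<psi>) x, (\<sigma> \<circ> \<psi>) y) \<in> t"
    using mono \<psi>\<sigma> \<sigma>K unfolding t_def by auto
  moreover have "\<forall>\<gamma>\<in>carrier G. \<forall>x\<in>I. (\<sigma> \<circ> \<psi>) (\<phi> \<gamma> x) = \<Theta> \<gamma> ((\<sigma> \<circ> \<psi>) x)"
    using \<Theta>\<psi> by simp
  ultimately have "inj_on (\<sigma> \<circ> \<psi>) I \<or> is_singleton ((\<sigma> \<circ> \<psi>) ` I)"
    using prim unfolding primitive_action_def by blast
  then show "inj_on \<psi> I \<or> is_singleton (\<psi> ` I)"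
  proof
    assume "inj_on (\<sigma> \<circ> \<psi>) I"
    then show ?thesis by (auto dest: inj_on_imageI2)
  next
    assume "is_singleton ((\<sigma> \<circ> \<psi>) ` I)"
    moreover have "\<psi> ` (\<sigma> \<circ> \<psi>) ` I = \<psi> ` I" using \<psi>\<sigma> by (auto simp: image_iff)
    ultimately show ?thesis by (metis image_empty image_insert is_singleton_def)
  qed
qed

end

theory Submission
  imports Defs
begin

text \<open>Proximality forces \<open>I\<close> (if it has at least three points) to be dense without endpoints, so a
  pair collapsed by an equivariant map can be moved over any other pair, which then collapses too.

  Conversely, by primitivity every monotone equivariant map \<open>F\<close> from \<open>I\<close> to a chain of subsets of
  \<open>I\<close> is injective or constant. Apply this to three such maps.
  \<^item> \<open>F x = {t. \<exists>g. t \<le> g x}\<close> is not injective, so all orbits are unbounded.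
  \<^item> Let \<open>h\<close> move \<open>w\<close> and have its support in \<open>(p, q)\<close>. For
    \<open>F x = {t. \<exists>g. g p \<le> x \<and> t \<le> g q}\<close>, the set \<open>F w\<close> is an initial segment containing
    \<open>q\<close>, so \<open>F (h w) = h (F w) = F w\<close>. Hence \<open>F\<close> is constant, and translates of \<open>(p, q)\<close>
    cover every bounded set.
  \<^item> Let \<open>F x\<close> be the set of \<open>y\<close> such that the translates of \<open>(x, y)\<close> do not cover every bounded
    set. Then \<open>y \<in> F x\<close> is transitive, and \<open>q \<notin> F p\<close>. So \<open>F\<close> is injective and no pair \<open>x < y\<close>
    has \<open>y \<in> F x\<close>.\<close>

section \<open>Group actions by order automorphisms of a chain\<close>

locale order_action = group_action G I \<phi>
  for G :: "('g, 'm) monoid_scheme" and I :: "'i set" and \<phi> +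
  fixes r :: "'i rel"
  assumes linear: "linear_order_on I r"
    and act_auto: "\<forall>g\<in>carrier G. \<phi> g \<in> order_auto I r"
begin

sublocale G: group G
  using group_hom by (simp add: group_hom_def)

lemma le_refl: "x \<in> I \<Longrightarrow> (x, x) \<in> r"
  using linear by (auto simp: order_on_defs refl_on_def)

lemma le_trans: "(x, y) \<in> r \<Longrightarrow> (y, z) \<in> r \<Longrightarrow> (x, z) \<in> r"
  using linear by (auto simp: order_on_defs dest: transD)

lemma le_antisym: "(x, y) \<in> r \<Longrightarrow> (y, x) \<in> r \<Longrightarrow> x = y"
  using linear by (auto simp: order_on_defs dest: antisymD)

lemma le_total: "x \<in> I \<Longrightarrow> y \<in> I \<Longrightarrow> (x, y) \<in> r \<or> (y, x) \<in> r"
  using linear le_refl by (fastforce simp: order_on_defs total_on_def)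

lemma le_carrier: "(x, y) \<in> r \<Longrightarrow> x \<in> I \<and> y \<in> I"
  using linear by (auto simp: order_on_defs)

lemma act_in: "g \<in> carrier G \<Longrightarrow> x \<in> I \<Longrightarrow> \<phi> g x \<in> I"
  using element_image by blast

lemma act_mult:
  "g \<in> carrier G \<Longrightarrow> h \<in> carrier G \<Longrightarrow> x \<in> I \<Longrightarrow> \<phi> (g \<otimes>\<^bsub>G\<^esub> h) x = \<phi> g (\<phi> h x)"
  using composition_rule by simp

lemma act_one: "x \<in> I \<Longrightarrow> \<phi> \<one>\<^bsub>G\<^esub> x = x"
  using id_eq_one by (metis restrict_apply')

lemma act_inv_left: "g \<in> carrier G \<Longrightarrow> x \<in> I \<Longrightarrow> \<phi> (inv\<^bsub>G\<^esub> g) (\<phi> g x) = x"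
  using act_mult[of "inv\<^bsub>G\<^esub> g" g x] act_one by simp

lemma act_inv_right: "g \<in> carrier G \<Longrightarrow> x \<in> I \<Longrightarrow> \<phi> g (\<phi> (inv\<^bsub>G\<^esub> g) x) = x"
  using act_mult[of g "inv\<^bsub>G\<^esub> g" x] act_one by simp

lemma act_mono: "g \<in> carrier G \<Longrightarrow> (x, y) \<in> r \<Longrightarrow> (\<phi> g x, \<phi> g y) \<in> r"
  using act_auto by (auto simp: order_auto_def)

lemma act_inj: "g \<in> carrier G \<Longrightarrow> x \<in> I \<Longrightarrow> y \<in> I \<Longrightarrow> \<phi> g x = \<phi> g y \<longleftrightarrow> x = y"
  by (metis act_inv_left)

lemma act_le_inv_iff:
  assumes "g \<in> carrier G" "x \<in> I" "y \<in> I"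
  shows "(x, \<phi> (inv\<^bsub>G\<^esub> g) y) \<in> r \<longleftrightarrow> (\<phi> g x, y) \<in> r"
  using assms act_mono act_inv_left act_inv_right by (metis G.inv_closed)

lemma act_inv_le_iff:
  assumes "g \<in> carrier G" "x \<in> I" "y \<in> I"
  shows "(\<phi> (inv\<^bsub>G\<^esub> g) x, y) \<in> r \<longleftrightarrow> (x, \<phi> g y) \<in> r"
  using assms act_mono act_inv_left act_inv_right by (metis G.inv_closed)

text \<open>The hypotheses are symmetric under order reversal, so a result about upper ends also
  yields its mirror image about lower ends.\<close>

lemma converse_order_action: "order_action G I \<phi> (r\<inverse>)"
  using group_action_axioms linear act_auto
  by (auto simp: order_action_def order_action_axioms_def order_auto_def)

section \<open>Proximal actions are primitive\<close>

lemma proximal_converse: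
  assumes "proximal_action G I r \<phi>"
  shows "proximal_action G I (r\<inverse>) \<phi>"
proof -
  have "open_interval I (r\<inverse>) a b = open_interval I r b a" for a b
    by (auto simp: open_interval_def)
  then show ?thesis
    using assms unfolding proximal_action_def by (metis Diff_iff converse_iff converse_Id)
qed

text \<open>Some translate of the interval from \<open>x\<close> to \<open>y\<close> contains
  \<open>b\<close>, so that interval is nonempty. Three points are required: on a two-point chain
  every action is proximal, yet nothing lies in between.\<close>

lemma proximal_dense:
  assumes prox: "proximal_action G I r \<phi>"
    and abc: "(a, b) \<in> r - Id" "(b, c) \<in> r - Id" and xy: "(x, y) \<in> r - Id"
  obtains z where "(x, z) \<in> r - Id" "(z, y) \<in> r - Id"
proof -
  have "(a, c) \<in> r - Id" using abc le_trans le_antisym by blast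
  then obtain g where "open_interval I r a c \<subseteq> \<phi> g ` open_interval I r x y"
    using prox xy le_carrier unfolding proximal_action_def by (metis DiffD1)
  moreover have "b \<in> open_interval I r a c"
    using abc le_carrier by (auto simp: open_interval_def)
  ultimately show thesis using that by (auto simp: open_interval_def)
qed

text \<open>A greatest element \<open>m\<close> would be fixed by every \<open>g\<close>. The image
  of the interval from \<open>a\<close> to \<open>b\<close> then stays below
  \<open>\<phi> g b\<close>, which is less than \<open>m\<close>, so by density it cannot cover the
  interval from \<open>b\<close> to \<open>m\<close>.\<close>

lemma proximal_no_top:
  assumes prox: "proximal_action G I r \<phi>"
    and abc: "(a, b) \<in> r - Id" "(b, c) \<in> r - Id" and m: "m \<in> I"
  obtains m' where "(m, m') \<in> r - Id"
proof (rule ccontr)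
  assume "\<not> thesis"
  then have top: "(x, m) \<in> r" if "x \<in> I" for x
    using le_total[OF that m] \<open>\<not> thesis\<close> \<open>\<And>m'. (m, m') \<in> r - Id \<Longrightarrow> thesis\<close> le_refl[OF m] by auto
  have I: "a \<in> I" "b \<in> I" "c \<in> I" using abc le_carrier by auto
  have bm: "(b, m) \<in> r - Id" using top[of c] abc I le_trans le_antisym by blast
  then obtain g where g: "g \<in> carrier G" and
    sub: "open_interval I r b m \<subseteq> \<phi> g ` open_interval I r a b"
    using prox abc I m unfolding proximal_action_def by blast
  \<comment> \<open>That \<open>m\<close> is at most \<open>\<phi> g m\<close> comes from maximality
    applied to the image of \<open>m\<close> under the inverse of \<open>g\<close>.\<close>
  have gm: "\<phi> g m = m"
    using top act_in[OF _ m] g m act_inv_le_iff le_antisym G.inv_closed by metis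
  then have gb: "(\<phi> g b, m) \<in> r - Id"
    using top act_in g I(2) m bm act_inj by (metis DiffI DiffD2 pair_in_Id_conv)
  \<comment> \<open>\<open>e\<close> is the larger of \<open>b\<close> and
    \<open>\<phi> g b\<close>; a point between \<open>e\<close> and \<open>m\<close> lies in the
    target but above the image.\<close>
  obtain e where e: "(e, m) \<in> r - Id" "(b, e) \<in> r" "(\<phi> g b, e) \<in> r"
    using bm gb le_total[OF I(2) act_in[OF g I(2)]] le_refl I act_in g by metis
  obtain t where t: "(e, t) \<in> r - Id" "(t, m) \<in> r - Id"
    using proximal_dense[OF prox abc e(1)] .
  then have "t \<in> open_interval I r b m"
    using e le_trans le_antisym le_carrier unfolding open_interval_def by blast
  then obtain s where "t = \<phi> g s" "(s, b) \<in> r" using sub by (auto simp: open_interval_def)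
  then have "(t, e) \<in> r" using act_mono[OF g] e le_trans by blast
  then show False using t le_antisym by blast
qed

lemma proximal_imp_primitive:
  assumes prox: "proximal_action G I r \<phi>"
  shows "primitive_action TYPE('j) G I r \<phi>"
  unfolding primitive_action_def
proof (intro allI impI)
  fix J :: "'j set" and s \<Psi> \<psi>
  assume lin: "linear_order_on J s"
    and mono: "\<forall>x\<in>I. \<forall>y\<in>I. (x, y) \<in> r \<longrightarrow> (\<psi> x, \<psi> y) \<in> s"
    and equi: "\<forall>g\<in>carrier G. \<forall>x\<in>I. \<psi> (\<phi> g x) = \<Psi> g (\<psi> x)"
  show "inj_on \<psi> I \<or> is_singleton (\<psi> ` I)"
  proof (cases "inj_on \<psi> I")
    case False
    then obtain x y where xy: "(x, y) \<in> r - Id" and eq: "\<psi> x = \<psi> y"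
      unfolding inj_on_def using le_total by (metis DiffI pair_in_Id_conv)
    have I: "x \<in> I" "y \<in> I" using xy le_carrier by auto
    have const: "\<psi> z = \<psi> x" if "(x, z) \<in> r" "(z, y) \<in> r" for z
      using lin mono that eq le_carrier unfolding order_on_defs by (metis antisymD)
    \<comment> \<open>Open intervals omit their endpoints, so \<open>u\<close> and \<open>v\<close>
      are first enclosed strictly between \<open>u'\<close> and \<open>v'\<close>. A translate of
      the collapsed interval then contains both.\<close>
    have all: "\<psi> u = \<psi> v" if abc: "(a, b) \<in> r - Id" "(b, c) \<in> r - Id"
      and uv: "(u, v) \<in> r" for a b c u v
    proof -
      have UV: "u \<in> I" "v \<in> I" using uv le_carrier by auto
      obtain v' where v': "(v, v') \<in> r - Id" using proximal_no_top[OF prox abc UV(2)] .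
      have "(c, b) \<in> r\<inverse> - Id" "(b, a) \<in> r\<inverse> - Id" using abc by auto
      then obtain u' where u': "(u, u') \<in> r\<inverse> - Id"
        by (rule order_action.proximal_no_top[OF converse_order_action proximal_converse[OF prox]])
          (use UV in auto)
      then have u': "(u', u) \<in> r - Id" by auto
      have "(u', v') \<in> r - Id" using u' v' uv le_trans le_antisym by blast
      then obtain g where g: "g \<in> carrier G" and
        sub: "open_interval I r u' v' \<subseteq> \<phi> g ` open_interval I r x y"
        using prox xy le_carrier unfolding proximal_action_def by (metis DiffD1)
      have "\<psi> t = \<Psi> g (\<psi> x)" if "t \<in> open_interval I r u' v'" for t
        using that sub equi g const by (fastforce simp: open_interval_def)
      moreover have "u \<in> open_interval I r u' v'" "v \<in> open_interval I r u' v'"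
        using u' v' uv UV le_trans le_antisym unfolding open_interval_def by blast+
      ultimately show ?thesis by metis
    qed
    \<comment> \<open>A point outside the closed interval from \<open>x\<close> to \<open>y\<close>
      forms with them the three-point chain that \<open>all\<close> asks for.\<close>
    have \<psi>x: "\<psi> z = \<psi> x" if z: "z \<in> I" for z
    proof (cases "z = x \<or> z = y")
      case False
      then consider "(z, x) \<in> r - Id" | "(y, z) \<in> r - Id" | "(x, z) \<in> r" "(z, y) \<in> r"
        using le_total I z by (metis DiffI pair_in_Id_conv)
      then show ?thesis
        by cases (use all[OF _ xy] all[OF xy] const eq in \<open>fastforce+\<close>)
    qed (use eq in auto)
    have "\<psi> ` I = (\<lambda>_. \<psi> x) ` I" by (rule image_cong[OF refl \<psi>x])
    also have "\<dots> = {\<psi> x}" using I by blast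
    finally show ?thesis by (simp add: is_singleton_def)
  qed simp
qed

section \<open>Testing primitivity with set-valued maps\<close>

lemma primitive_dichotomy:
  assumes prim: "primitive_action TYPE('i) G I r \<phi>"
    and sub: "\<And>x. x \<in> I \<Longrightarrow> F x \<subseteq> I"
    and mono: "\<And>x y. (x, y) \<in> r \<Longrightarrow> F x \<subseteq> F y"
    and equi: "\<And>g x. g \<in> carrier G \<Longrightarrow> x \<in> I \<Longrightarrow> F (\<phi> g x) = \<phi> g ` F x"
  shows "inj_on F I \<or> (\<forall>x\<in>I. \<forall>y\<in>I. F x = F y)"
proof -
  \<comment> \<open>By monotonicity the image of \<open>F\<close> is a chain under inclusion; by
    equivariance the group acts on it by direct images.\<close>
  define J where "J = F ` I"
  define s where "s = {(A, B). A \<in> J \<and> B \<in> J \<and> A \<subseteq> B}"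
  define \<Psi> where "\<Psi> = (\<lambda>g. \<lambda>A\<in>J. \<phi> g ` A)"
  have \<Psi>J: "\<Psi> g A \<in> J" if "g \<in> carrier G" "A \<in> J" for g A
    using that equi[symmetric] act_in unfolding \<Psi>_def J_def by auto
  have JI: "A \<subseteq> I" if "A \<in> J" for A using that sub unfolding J_def by auto
  have \<Psi>mult: "\<Psi> (g \<otimes>\<^bsub>G\<^esub> h) A = \<Psi> g (\<Psi> h A)"
    if gh: "g \<in> carrier G" "h \<in> carrier G" and A: "A \<in> J" for g h A
  proof -
    have "\<phi> (g \<otimes>\<^bsub>G\<^esub> h) ` A = \<phi> g ` \<phi> h ` A"
      unfolding image_image by (rule image_cong) (use act_mult gh JI[OF A] in auto)
    then show ?thesis using \<Psi>J[OF gh(2) A] A by (simp add: \<Psi>_def)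
  qed
  have \<Psi>one: "\<Psi> \<one>\<^bsub>G\<^esub> A = A" if A: "A \<in> J" for A
  proof -
    have "\<phi> \<one>\<^bsub>G\<^esub> ` A = id ` A" by (rule image_cong) (use act_one JI[OF A] in auto)
    then show ?thesis using A by (simp add: \<Psi>_def)
  qed
  have \<Psi>bij: "\<Psi> g \<in> Bij J" if g: "g \<in> carrier G" for g
  proof -
    have "bij_betw (\<Psi> g) J J"
      by (rule bij_betw_byWitness[where f' = "\<Psi> (inv\<^bsub>G\<^esub> g)"])
        (use g \<Psi>J \<Psi>mult[symmetric] \<Psi>one in auto)
    then show ?thesis unfolding Bij_def \<Psi>_def by auto
  qed
  have "\<Psi> \<in> hom G (OrderAutGroup J s)"
  proof (rule homI)
    fix g assume g: "g \<in> carrier G"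
    have "(\<Psi> g A, \<Psi> g B) \<in> s" if "(A, B) \<in> s" for A B
      using that \<Psi>J[OF g] unfolding s_def by (auto simp: \<Psi>_def)
    then show "\<Psi> g \<in> carrier (OrderAutGroup J s)"
      using \<Psi>bij[OF g] by (auto simp: OrderAutGroup_def order_auto_def)
  next
    fix g h assume gh: "g \<in> carrier G" "h \<in> carrier G"
    have "\<Psi> (g \<otimes>\<^bsub>G\<^esub> h) = compose J (\<Psi> g) (\<Psi> h)"
      by (rule extensionalityI[of _ J])
        (use gh \<Psi>mult Bij_imp_extensional[OF \<Psi>bij] in \<open>auto simp: compose_def\<close>)
    then show "\<Psi> (g \<otimes>\<^bsub>G\<^esub> h) = \<Psi> g \<otimes>\<^bsub>OrderAutGroup J s\<^esub> \<Psi> h"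
      using gh \<Psi>bij by (simp add: OrderAutGroup_def BijGroup_def)
  qed
  moreover have "linear_order_on J s"
  proof -
    have "A \<subseteq> B \<or> B \<subseteq> A" if "A \<in> J" "B \<in> J" for A B
      using that le_total mono unfolding J_def by blast
    then show ?thesis
      by (auto simp: s_def order_on_defs refl_on_def trans_def antisym_def total_on_def)
  qed
  moreover have "F \<in> I \<rightarrow> J" by (auto simp: J_def)
  moreover have "\<forall>x\<in>I. \<forall>y\<in>I. (x, y) \<in> r \<longrightarrow> (F x, F y) \<in> s"
    using mono by (auto simp: s_def J_def)
  moreover have "\<forall>g\<in>carrier G. \<forall>x\<in>I. F (\<phi> g x) = \<Psi> g (F x)"
    using equi by (auto simp: \<Psi>_def J_def)
  ultimately have "inj_on F I \<or> is_singleton (F ` I)"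
    \<comment> \<open>Elements of \<open>J\<close> are subsets of \<open>I\<close>, so primitivity
      is transferred from type \<open>'i\<close> to \<open>'i set\<close>.\<close>
    using primitive_action_any_type[OF group_action_axioms prim, where 'j = "'i set"]
    unfolding primitive_action_def by blast
  then show ?thesis by (metis image_eqI is_singletonE singletonD)
qed

text \<open>It suffices to check one inclusion of the equivariance, the other one being its instance for
  the inverse.\<close>

lemma equivariant_setI:
  assumes sub: "\<And>x. x \<in> I \<Longrightarrow> F x \<subseteq> I"
    and fwd: "\<And>g x t. g \<in> carrier G \<Longrightarrow> x \<in> I \<Longrightarrow> t \<in> F x \<Longrightarrow> \<phi> g t \<in> F (\<phi> g x)"
    and g: "g \<in> carrier G" and x: "x \<in> I"
  shows "F (\<phi> g x) = \<phi> g ` F x"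
proof
  show "F (\<phi> g x) \<subseteq> \<phi> g ` F x"
  proof
    fix t assume t: "t \<in> F (\<phi> g x)"
    then have "\<phi> (inv\<^bsub>G\<^esub> g) t \<in> F x"
      using fwd[of "inv\<^bsub>G\<^esub> g" "\<phi> g x" t] g x act_in act_inv_left by simp
    moreover have "t = \<phi> g (\<phi> (inv\<^bsub>G\<^esub> g) t)"
      using act_inv_right g t sub act_in x by (metis subsetD)
    ultimately show "t \<in> \<phi> g ` F x" by blast
  qed
qed (use fwd g x in auto)

section \<open>Bounded primitive actions are proximal\<close>

lemma primitive_orbit_cofinal:
  assumes prim: "primitive_action TYPE('i) G I r \<phi>"
    and moved: "h \<in> carrier G" "w \<in> I" "\<phi> h w \<noteq> w"
    and xy: "x \<in> I" "y \<in> I"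
  shows "\<exists>g\<in>carrier G. (y, \<phi> g x) \<in> r"
proof -
  \<comment> \<open>The down-closure of the orbit of \<open>x\<close>. It depends only on the orbit,
    so it agrees at \<open>w\<close> and \<open>\<phi> h w\<close>, which rules out
    injectivity.\<close>
  define D where "D x = {t \<in> I. \<exists>g\<in>carrier G. (t, \<phi> g x) \<in> r}" for x
  have D_act_sub: "D (\<phi> g x) \<subseteq> D x" if "g \<in> carrier G" "x \<in> I" for g x
    unfolding D_def using that act_mult[symmetric] by auto
  have D_act: "D (\<phi> g x) = D x" if "g \<in> carrier G" "x \<in> I" for g x
    using D_act_sub[OF that] D_act_sub[of "inv\<^bsub>G\<^esub> g" "\<phi> g x"] that act_inv_left act_in by auto
  have "inj_on D I \<or> (\<forall>x\<in>I. \<forall>y\<in>I. D x = D y)"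
  proof (rule primitive_dichotomy[OF prim])
    show "D x \<subseteq> D y" if "(x, y) \<in> r" for x y
      unfolding D_def using that act_mono le_trans by blast
    show "D (\<phi> g x) = \<phi> g ` D x" if "g \<in> carrier G" "x \<in> I" for g x
    proof (rule equivariant_setI[OF _ _ that])
      show "\<phi> g t \<in> D (\<phi> g x)" if g: "g \<in> carrier G" and x: "x \<in> I" and t: "t \<in> D x" for g x t
      proof -
        obtain k where "k \<in> carrier G" "(t, \<phi> k x) \<in> r" using t by (auto simp: D_def)
        then have "(\<phi> g t, \<phi> (g \<otimes>\<^bsub>G\<^esub> k) x) \<in> r" "g \<otimes>\<^bsub>G\<^esub> k \<in> carrier G"
          using act_mono g act_mult x by auto
        then have "\<phi> g t \<in> D x" using le_carrier by (auto simp: D_def)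
        then show ?thesis using D_act g x by simp
      qed
    qed (auto simp: D_def)
  qed (auto simp: D_def)
  moreover have "\<not> inj_on D I"
    using D_act moved act_in unfolding inj_on_def by metis
  ultimately have "D x = D y" using xy by blast
  moreover have "y \<in> D y" unfolding D_def using xy act_one le_refl by force
  ultimately show ?thesis by (auto simp: D_def)
qed

lemma bounded_primitive_imp_proximal_interval:
  assumes prim: "primitive_action TYPE('i) G I r \<phi>"
    and h: "h \<in> carrier G" and w: "w \<in> I" "\<phi> h w \<noteq> w"
    and supp: "support_on I (\<phi> h) \<subseteq> open_interval I r p q"
    and cd: "c \<in> I" "d \<in> I"
  shows "\<exists>g\<in>carrier G. (\<phi> g p, c) \<in> r \<and> (d, \<phi> g q) \<in> r"
proof -
  note cofinal = primitive_orbit_cofinal[OF prim h w]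
  have wpq: "(p, w) \<in> r" "(w, q) \<in> r" "p \<in> I" "q \<in> I"
    using supp w le_carrier by (auto simp: support_on_def open_interval_def)
  \<comment> \<open>The claim amounts to \<open>d \<in> F c\<close>, so it suffices that
    \<open>F\<close> is constant and some value of \<open>F\<close> contains
    \<open>d\<close>.\<close>
  define F where "F x = {t \<in> I. \<exists>g\<in>carrier G. (\<phi> g p, x) \<in> r \<and> (t, \<phi> g q) \<in> r}" for x
  have F_down: "t \<in> F x" if "(t, u) \<in> r" "u \<in> F x" for t u x
    using that le_trans le_carrier unfolding F_def by blast
  have F_equi: "F (\<phi> g x) = \<phi> g ` F x" if "g \<in> carrier G" "x \<in> I" for g x
  proof (rule equivariant_setI[OF _ _ that])
    show "\<phi> g t \<in> F (\<phi> g x)" if g: "g \<in> carrier G" and x: "x \<in> I" and t: "t \<in> F x" for g x t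
    proof -
      obtain k where "k \<in> carrier G" "(\<phi> k p, x) \<in> r" "(t, \<phi> k q) \<in> r"
        using t by (auto simp: F_def)
      then have "g \<otimes>\<^bsub>G\<^esub> k \<in> carrier G" "(\<phi> (g \<otimes>\<^bsub>G\<^esub> k) p, \<phi> g x) \<in> r"
        "(\<phi> g t, \<phi> (g \<otimes>\<^bsub>G\<^esub> k) q) \<in> r"
        using act_mono g act_mult wpq by auto
      then show ?thesis unfolding F_def using le_carrier by blast
    qed
  qed (auto simp: F_def)
  have dich: "inj_on F I \<or> (\<forall>x\<in>I. \<forall>y\<in>I. F x = F y)"
  proof (rule primitive_dichotomy[OF prim])
    show "F x \<subseteq> F y" if "(x, y) \<in> r" for x y
      unfolding F_def using that le_trans by blast
  qed (use F_equi in \<open>auto simp: F_def\<close>)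
  have "q \<in> F w" unfolding F_def using wpq act_one le_refl by (auto intro!: bexI[of _ "\<one>\<^bsub>G\<^esub>"])
  \<comment> \<open>Both \<open>h\<close> and its inverse fix \<open>q\<close> and everything above
    it, hence keep the points up to \<open>q\<close> there. The inverse is included so that
    \<open>h\<close> maps \<open>F w\<close> onto itself, not merely into itself.\<close>
  have fix_or: "\<phi> k t = t \<or> (\<phi> k t, q) \<in> r"
    if k: "k = h \<or> k = inv\<^bsub>G\<^esub> h" and t: "t \<in> I" for k t
  proof (rule disjCI)
    assume nq: "(\<phi> k t, q) \<notin> r"
    have kG: "k \<in> carrier G" using k h by auto
    have hfix: "\<phi> h u = u" if "u \<in> I" "(u, q) \<notin> r \<or> u = q" for u
      using supp that by (auto simp: support_on_def open_interval_def)
    have kfix: "\<phi> k u = u" if "u \<in> I" "(u, q) \<notin> r \<or> u = q" for u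
      using k hfix[OF that] act_inv_left[OF h that(1)] by metis
    have "(t, q) \<notin> r"
      using nq act_mono[OF kG] kfix[of q] wpq by metis
    then show "\<phi> k t = t" using kfix t by blast
  qed
  \<comment> \<open>A point that is not fixed lands at or below \<open>q\<close>, and
    \<open>F w\<close> is an initial segment containing \<open>q\<close>.\<close>
  have stab: "\<phi> k t \<in> F w" if "k = h \<or> k = inv\<^bsub>G\<^esub> h" "t \<in> F w" for k t
    using fix_or[OF that(1)] that(2) F_down \<open>q \<in> F w\<close> by (metis (no_types, lifting) F_def mem_Collect_eq)
  have "\<phi> h ` F w = F w"
  proof
    show "F w \<subseteq> \<phi> h ` F w"
    proof
      fix t assume t: "t \<in> F w"
      then have "t \<in> I" by (simp add: F_def)
      then show "t \<in> \<phi> h ` F w" using stab[OF _ t] act_inv_right[OF h, of t] by (metis imageI)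
    qed
  qed (use stab in auto)
  then have "F (\<phi> h w) = F w" using F_equi h w by simp
  then have "\<not> inj_on F I" using w act_in[OF h] unfolding inj_on_def by metis
  then have const: "F x = F y" if "x \<in> I" "y \<in> I" for x y using dich that by blast
  \<comment> \<open>Cofinality of the orbit of \<open>q\<close> puts \<open>d\<close> into
    \<open>F\<close> at a translate of \<open>p\<close>; constancy replaces that translate by
    \<open>c\<close>.\<close>
  obtain g where g: "g \<in> carrier G" "(d, \<phi> g q) \<in> r" using cofinal wpq cd by blast
  then have "d \<in> F (\<phi> g p)" using cd act_in wpq le_refl by (auto simp: F_def)
  then have "d \<in> F c" using const act_in g wpq cd by metis
  then show ?thesis by (auto simp: F_def)
qed

text \<open>One pair that cannot be stretched would, by primitivity, make every pair fail, including
  the ends of an interval around the support of \<open>h\<close>, which are known to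
  stretch.\<close>

lemma bounded_primitive_proximal_points:
  assumes prim: "primitive_action TYPE('i) G I r \<phi>" and bdd: "bounded_action G I r \<phi>"
    and moved: "h \<in> carrier G" "w \<in> I" "\<phi> h w \<noteq> w"
    and xy: "(x, y) \<in> r - Id" and cd: "c \<in> I" "d \<in> I"
  shows "\<exists>g\<in>carrier G. (\<phi> g x, c) \<in> r \<and> (d, \<phi> g y) \<in> r"
proof (rule ccontr)
  assume nonprox: "\<not> ?thesis"
  note cofinal = primitive_orbit_cofinal[OF prim moved]
  have coinitial: "\<exists>g\<in>carrier G. (\<phi> g u, v) \<in> r" if uv: "u \<in> I" "v \<in> I" for u v
    using cofinal[OF uv(2,1)] act_inv_le_iff uv by (meson G.inv_closed)
  have xyI: "x \<in> I" "y \<in> I" using xy le_carrier by auto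
  define B where "B x y c d \<longleftrightarrow> (\<forall>g\<in>carrier G. (\<phi> g x, c) \<in> r \<longrightarrow> (d, \<phi> g y) \<notin> r)" for x y c d
  define F where "F x = {y \<in> I. \<exists>c\<in>I. \<exists>d\<in>I. B x y c d}" for x
  \<comment> \<open>The left bound of a failing target is arbitrary: some \<open>k\<close> moves
    \<open>c'\<close> to or below \<open>c\<close>, and \<open>d\<close> is pulled back by the
    inverse of \<open>k\<close>.\<close>
  have B_shift: "\<exists>d'\<in>I. B u v c' d'"
    if B: "B u v c d" and I: "u \<in> I" "v \<in> I" "c \<in> I" "d \<in> I" "c' \<in> I" for u v c d c'
  proof -
    obtain k where k: "k \<in> carrier G" "(\<phi> k c', c) \<in> r" using coinitial I by blast
    have "B u v c' (\<phi> (inv\<^bsub>G\<^esub> k) d)"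
      unfolding B_def
    proof (intro ballI impI notI)
      fix g assume g: "g \<in> carrier G" "(\<phi> g u, c') \<in> r" "(\<phi> (inv\<^bsub>G\<^esub> k) d, \<phi> g v) \<in> r"
      have "(\<phi> (k \<otimes>\<^bsub>G\<^esub> g) u, c) \<in> r"
        using act_mono[OF k(1) g(2)] k g act_mult I le_trans by metis
      moreover have "(d, \<phi> (k \<otimes>\<^bsub>G\<^esub> g) v) \<in> r"
        using g k act_inv_le_iff act_in act_mult I by simp
      ultimately show False using B k g unfolding B_def by blast
    qed
    then show ?thesis using act_in k I by blast
  qed
  have F_trans: "v \<in> F t" if u: "u \<in> F t" and v: "v \<in> F u" and t: "t \<in> I" for t u v
  proof -
    obtain c d where 1: "u \<in> I" "c \<in> I" "d \<in> I" "B t u c d" using u by (auto simp: F_def)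
    obtain d' where 2: "d' \<in> I" "B u v d d'" using v 1 B_shift by (force simp: F_def)
    \<comment> \<open>Failures chain: if \<open>\<phi> g t\<close> is at most \<open>c\<close>, then
      \<open>\<phi> g u\<close> stays below \<open>d\<close>, hence \<open>\<phi> g v\<close> below
      \<open>d'\<close>.\<close>
    have "B t v c d'"
      unfolding B_def
      using 1 2 le_total act_in unfolding B_def by metis
    then show ?thesis using 1 2 v by (auto simp: F_def)
  qed
  have F_refl: "v \<in> F u" if vu: "(v, u) \<in> r" for u v
  proof -
    \<comment> \<open>The pair \<open>x\<close>, \<open>y\<close> serves as the target: covering it
      by a reversed pair would force \<open>y\<close> to be at most \<open>x\<close>.\<close>
    have "B u v x y"
      unfolding B_def
    proof (intro ballI impI notI)
      fix g assume g: "g \<in> carrier G" "(\<phi> g u, x) \<in> r" "(y, \<phi> g v) \<in> r"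
      then have "(y, x) \<in> r" using act_mono[OF g(1) vu] le_trans by blast
      then show False using xy le_antisym by blast
    qed
    then show ?thesis using xyI vu le_carrier by (auto simp: F_def)
  qed
  have dich: "inj_on F I \<or> (\<forall>x\<in>I. \<forall>y\<in>I. F x = F y)"
  proof (rule primitive_dichotomy[OF prim])
    show "F u \<subseteq> F v" if "(u, v) \<in> r" for u v
      using F_trans[OF F_refl[OF that]] le_carrier[OF that] by blast
    show "F (\<phi> g u) = \<phi> g ` F u" if "g \<in> carrier G" "u \<in> I" for g u
    proof (rule equivariant_setI[OF _ _ that])
      show "\<phi> g t \<in> F (\<phi> g u)" if g: "g \<in> carrier G" and u: "u \<in> I" and t: "t \<in> F u" for g u t
      proof -
        obtain c d where cd: "t \<in> I" "c \<in> I" "d \<in> I" "B u t c d" using t by (auto simp: F_def)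
        have "B (\<phi> g u) (\<phi> g t) c d"
          using cd g u act_mult[symmetric] unfolding B_def by auto
        then show ?thesis using cd g act_in by (auto simp: F_def)
      qed
    qed (auto simp: F_def)
  qed (auto simp: F_def)
  \<comment> \<open>Membership in both directions and transitivity give \<open>F x = F y\<close>, so
    \<open>F\<close> is not injective.\<close>
  have "y \<in> F x" using nonprox cd xyI unfolding F_def B_def by blast
  moreover have "x \<in> F y" using F_refl xy by blast
  ultimately have "F x = F y" using F_trans xyI by blast
  then have const: "F u = F v" if "u \<in> I" "v \<in> I" for u v
    using dich that xy xyI unfolding inj_on_def by blast
  obtain p q where pq: "p \<in> I" "q \<in> I" "support_on I (\<phi> h) \<subseteq> open_interval I r p q"
    using bdd moved unfolding bounded_action_def by blast
  have "q \<in> F p" using const F_refl le_refl pq by metis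
  then obtain c' d' where "c' \<in> I" "d' \<in> I" "B p q c' d'" by (auto simp: F_def)
  then show False
    using bounded_primitive_imp_proximal_interval[OF prim moved pq(3)] unfolding B_def by blast
qed

text \<open>Handles the case where no point is moved and orbits are not cofinal. Every monotone map
  is then equivariant, and the two-valued step at \<open>d\<close> contradicts primitivity once a
  third point lies between \<open>c\<close> and \<open>d\<close>.\<close>

lemma primitive_trivial_action:
  assumes prim: "primitive_action TYPE('i) G I r \<phi>"
    and triv: "\<And>g x. g \<in> carrier G \<Longrightarrow> x \<in> I \<Longrightarrow> \<phi> g x = x"
    and cd: "(c, d) \<in> r - Id"
  shows "open_interval I r c d = {}"
proof (rule ccontr)
  assume "open_interval I r c d \<noteq> {}"
  then obtain z where z: "z \<in> I" "(c, z) \<in> r - Id" "(z, d) \<in> r - Id"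
    by (auto simp: open_interval_def)
  define F where "F x = {t \<in> I. (d, x) \<in> r}" for x
  have "inj_on F I \<or> (\<forall>x\<in>I. \<forall>y\<in>I. F x = F y)"
  proof (rule primitive_dichotomy[OF prim])
    show "F x \<subseteq> F y" if "(x, y) \<in> r" for x y using that le_trans by (auto simp: F_def)
    show "F (\<phi> g x) = \<phi> g ` F x" if "g \<in> carrier G" "x \<in> I" for g x
      by (rule equivariant_setI[OF _ _ that]) (auto simp: F_def triv)
  qed (auto simp: F_def)
  moreover have "(d, c) \<notin> r" "(d, z) \<notin> r" using cd z le_antisym by blast+
  then have "F c = {}" "F z = {}" by (auto simp: F_def)
  moreover have "d \<in> F d" using cd le_refl le_carrier by (auto simp: F_def)
  ultimately show False
    using z cd le_carrier unfolding inj_on_def by (metis DiffD1 DiffD2 empty_iff pair_in_Id_conv)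
qed

lemma bounded_primitive_imp_proximal:
  assumes prim: "primitive_action TYPE('i) G I r \<phi>" and bdd: "bounded_action G I r \<phi>"
  shows "proximal_action G I r \<phi>"
  unfolding proximal_action_def
proof (intro ballI impI)
  fix a b c d
  assume I: "a \<in> I" "b \<in> I" "c \<in> I" "d \<in> I" and ab: "(a, b) \<in> r - Id" and cd: "(c, d) \<in> r - Id"
  show "\<exists>g\<in>carrier G. open_interval I r c d \<subseteq> \<phi> g ` open_interval I r a b"
  proof (cases "\<exists>h\<in>carrier G. \<exists>w\<in>I. \<phi> h w \<noteq> w")
    case True
    then obtain g where g: "g \<in> carrier G" "(\<phi> g a, c) \<in> r" "(d, \<phi> g b) \<in> r"
      using bounded_primitive_proximal_points[OF prim bdd _ _ _ ab I(3,4)] by blast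
    have "t \<in> \<phi> g ` open_interval I r a b" if t: "t \<in> open_interval I r c d" for t
    proof -
      define s where "s = \<phi> (inv\<^bsub>G\<^esub> g) t"
      have tI: "t \<in> I" and ct: "(c, t) \<in> r - Id" and td: "(t, d) \<in> r - Id"
        using t by (auto simp: open_interval_def)
      have sI: "s \<in> I" and gs: "\<phi> g s = t"
        unfolding s_def using tI g act_in act_inv_right by auto
      \<comment> \<open>Weak inequalities at the ends suffice because \<open>t\<close> lies strictly
        inside.\<close>
      have "(\<phi> g a, t) \<in> r - Id" "(t, \<phi> g b) \<in> r - Id"
        using ct td g le_trans le_antisym by blast+
      then have "(a, s) \<in> r - Id" "(s, b) \<in> r - Id"
        using act_le_inv_iff[OF g(1) I(1) tI] act_inv_le_iff[OF g(1) tI I(2)] gs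
        unfolding s_def by auto
      then show ?thesis using gs sI by (auto simp: open_interval_def)
    qed
    then show ?thesis using g by blast
  next
    case False
    then have "open_interval I r c d = {}" by (intro primitive_trivial_action[OF prim _ cd]) blast
    then show ?thesis by auto
  qed
qed

end

theorem theorem4p1:
  fixes \<Gamma> :: "('g, 'm) monoid_scheme" and I :: "'i set" and r :: "'i rel"
    and \<phi> :: "'g \<Rightarrow> 'i \<Rightarrow> 'i"
  assumes "linear_order_on I r"
    and "faithful_action \<Gamma> I \<phi>"
    and "\<forall>\<gamma>\<in>carrier \<Gamma>. \<phi> \<gamma> \<in> order_auto I r"
  shows "(proximal_action \<Gamma> I r \<phi> \<longrightarrow> primitive_action TYPE('j) \<Gamma> I r \<phi>) \<and>
    (bounded_action \<Gamma> I r \<phi> \<and> primitive_action TYPE('i) \<Gamma> I r \<phi> \<longrightarrow> proximal_action \<Gamma> I r \<phi>)"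
proof -
  interpret order_action \<Gamma> I \<phi> r
    using assms by (simp add: order_action_def order_action_axioms_def faithful_action_def)
  show ?thesis using proximal_imp_primitive bounded_primitive_imp_proximal by blast
qed

end
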